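(* Suppose that a constant equilibrium state $(\rho_*,m_* )\in\mathbb{R}^2$ with $\rho_*>0$ is supersonic, that is, $$p'(\rho_* )<\frac{m_*^2}{\rho_*^2}.$$ Then the operator $\mathcal{A}=-A_*\partial_x+B_*\partial_x^2+C_*\partial_x^3$ violates the strict dissipativity condition. More precisely, there exist certain values of $\xi\in\mathbb{R}$ for which the spectral equation $$\big(\lambda I+i\xi A_*+\xi^2B_*+i\xi^3C_*\big)\widehat U=0$$ has a solution $\lambda=\lambda(\xi)\in\mathbb{C}$ (with some $\widehat U\in\mathbb{C}^2$, $\widehat U\ne0$) satisfying $\operatorname{Re}\lambda(\xi)>0$.
   Context: Here $p(\rho)=\rho^\gamma$ with $\gamma>1$, $\mu>0$ and $k>0$ are constants, and $$A_*=\begin{pmatrix}0&1\\ p'(\rho_* )-m_*^2/\rho_*^2&2m_*/\rho_*\end{pmatrix},\quad B_*=\begin{pmatrix}0&0\\0&\mu\end{pmatrix},\quad C_*=\begin{pmatrix}0&0\\ \tfrac12k^2&0\end{pmatrix}.$$ The operator $\mathcal{A}$ is called strictly dissipative if for each $\xi\ne0$ all solutions $\lambda\in\mathbb{C}$ of the spectral equation (i.e. all $\lambda$ admitting a nontrivial $\widehat U\in\mathbb{C}^2$) satisfy $\operatorname{Re}\lambda(\xi)<0$. *)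

theory Defs
  imports "HOL-Analysis.Analysis"
begin

text \<open>Pressure law with adiabatic exponent \<open>\<gamma>\<close>; only used at positive densities.\<close>

definition pressure :: "real \<Rightarrow> real \<Rightarrow> real" where
  "pressure \<gamma> \<rho> = \<rho> powr \<gamma>"

text \<open>The inner lists are the rows.\<close>

definition mat_A :: "real \<Rightarrow> real \<Rightarrow> real \<Rightarrow> real^2^2" where
  "mat_A \<gamma> \<rho> m = vector [vector [0, 1],
                      vector [deriv (pressure \<gamma>) \<rho> - m\<^sup>2 / \<rho>\<^sup>2, 2 * m / \<rho>]]"

definition mat_B :: "real \<Rightarrow> real^2^2" where
  "mat_B \<mu> = vector [vector [0, 0], vector [0, \<mu>]]"

definition mat_C :: "real \<Rightarrow> real^2^2" where
  "mat_C k = vector [vector [0, 0], vector [k\<^sup>2 / 2, 0]]"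

text \<open>The complex multiple \<open>c M\<close> of a real matrix \<open>M\<close>.\<close>

definition cscale :: "complex \<Rightarrow> real^'n^'m \<Rightarrow> complex^'n^'m" where
  "cscale c M = (\<chi> i j. c * complex_of_real (M $ i $ j))"

text \<open>
  The constant-coefficient operator \<open>- A \<partial>\<^sub>x + B \<partial>\<^sub>x\<^sup>2 + C \<partial>\<^sub>x\<^sup>3\<close> is represented by its real
  coefficient matrices. \<open>spectral_matrix A B C \<xi> lam\<close> is
  \<open>lam I + \<i> \<xi> A + \<xi>\<^sup>2 B + \<i> \<xi>\<^sup>3 C\<close>, that is, \<open>lam\<close> minus the Fourier symbol of the operator;
  see \<open>operator_plane_wave\<close> below.
\<close>

definition spectral_matrix ::
  "real^2^2 \<Rightarrow> real^2^2 \<Rightarrow> real^2^2 \<Rightarrow> real \<Rightarrow> complex \<Rightarrow> complex^2^2" where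
  "spectral_matrix A B C \<xi> lam =
     mat lam + cscale (\<i> * complex_of_real \<xi>) A
           + cscale (complex_of_real (\<xi>\<^sup>2)) B
           + cscale (\<i> * complex_of_real (\<xi> ^ 3)) C"

definition spectral_solution ::
  "real^2^2 \<Rightarrow> real^2^2 \<Rightarrow> real^2^2 \<Rightarrow> real \<Rightarrow> complex \<Rightarrow> bool" where
  "spectral_solution A B C \<xi> lam \<longleftrightarrow>
     (\<exists>U :: complex^2. U \<noteq> 0 \<and> spectral_matrix A B C \<xi> lam *v U = 0)"

definition strictly_dissipative :: "real^2^2 \<Rightarrow> real^2^2 \<Rightarrow> real^2^2 \<Rightarrow> bool" where
  "strictly_dissipative A B C \<longleftrightarrow>
     (\<forall>\<xi>. \<xi> \<noteq> 0 \<longrightarrow> (\<forall>lam. spectral_solution A B C \<xi> lam \<longrightarrow> Re lam < 0))"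

definition diff_operator ::
  "real^2^2 \<Rightarrow> real^2^2 \<Rightarrow> real^2^2 \<Rightarrow> (real \<Rightarrow> complex^2) \<Rightarrow> real \<Rightarrow> complex^2" where
  "diff_operator A B C U x =
     (let D = (\<lambda>V y. vector_derivative V (at y)) in
      - (cscale 1 A *v D U x) + cscale 1 B *v (D ^^ 2) U x + cscale 1 C *v (D ^^ 3) U x)"

lemma plane_wave_derivative:
  "vector_derivative (\<lambda>x. exp (\<i> * complex_of_real (\<xi> * x)) *s (W :: complex^2)) (at y) =
   exp (\<i> * complex_of_real (\<xi> * y)) *s ((\<i> * complex_of_real \<xi>) *s W)"
proof (rule vector_derivative_at)
  have "linear (\<lambda>z. z *s W)"
    by (rule linearI) (auto simp: vec_eq_iff algebra_simps)
  then have bl: "bounded_linear (\<lambda>z. z *s W)"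
    by (simp add: linear_conv_bounded_linear)
  have "((\<lambda>z. exp (\<i> * (complex_of_real \<xi> * z))) has_field_derivative
      exp (\<i> * (complex_of_real \<xi> * complex_of_real y)) * (\<i> * complex_of_real \<xi>))
      (at (complex_of_real y))"
    by (auto intro!: derivative_eq_intros)
  then have "((\<lambda>x. exp (\<i> * complex_of_real (\<xi> * x))) has_vector_derivative
      exp (\<i> * complex_of_real (\<xi> * y)) * (\<i> * complex_of_real \<xi>)) (at y)"
    using has_vector_derivative_real_field by fastforce
  from bounded_linear.has_vector_derivative [OF bl this]
  show "((\<lambda>x. exp (\<i> * complex_of_real (\<xi> * x)) *s W) has_vector_derivative
      exp (\<i> * complex_of_real (\<xi> * y)) *s ((\<i> * complex_of_real \<xi>) *s W)) (at y)"
    by (simp add: vector_smult_assoc)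
qed

lemma operator_plane_wave:
  "diff_operator A B C (\<lambda>x. exp (\<i> * complex_of_real (\<xi> * x)) *s W) x =
     exp (\<i> * complex_of_real (\<xi> * x)) *s (lam *s W - spectral_matrix A B C \<xi> lam *v W)"
proof -
  define D where "D = (\<lambda>V :: real \<Rightarrow> complex^2. \<lambda>y. vector_derivative V (at y))"
  define e where "e = (\<lambda>x. exp (\<i> * complex_of_real (\<xi> * x)))"
  define a where "a = \<i> * complex_of_real \<xi>"
  have D: "D (\<lambda>x. e x *s V) = (\<lambda>x. e x *s (a *s V))" for V
    unfolding D_def e_def a_def plane_wave_derivative ..
  have D2: "(D ^^ 2) (\<lambda>x. e x *s W) x = e x *s (a *s (a *s W))"
    by (simp only: eval_nat_numeral BitM.simps numeral_One One_nat_def funpow.simps o_apply id_apply D)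
  have D3: "(D ^^ 3) (\<lambda>x. e x *s W) x = e x *s (a *s (a *s (a *s W)))"
    by (simp only: eval_nat_numeral BitM.simps numeral_One One_nat_def funpow.simps o_apply id_apply D)
  have M: "spectral_matrix A B C \<xi> lam = mat lam + cscale a A - cscale (a * a) B - cscale (a * a * a) C"
  proof -
    have "complex_of_real (\<xi>\<^sup>2) = - (a * a)" "\<i> * complex_of_real (\<xi> ^ 3) = - (a * a * a)"
      by (simp_all add: a_def complex_eq_iff power2_eq_square power3_eq_cube)
    then show ?thesis
      by (simp add: vec_eq_iff spectral_matrix_def cscale_def a_def [symmetric] del: of_real_power)
  qed
  have "diff_operator A B C (\<lambda>x. e x *s W) x =
      - (cscale 1 A *v (e x *s (a *s W))) + cscale 1 B *v (e x *s (a *s (a *s W)))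
      + cscale 1 C *v (e x *s (a *s (a *s (a *s W))))"
    unfolding diff_operator_def Let_def D_def [symmetric] D2 D3 by (simp add: D)
  also have "\<dots> = e x *s (lam *s W - spectral_matrix A B C \<xi> lam *v W)"
    unfolding M
    by (simp add: vec_eq_iff forall_2 cscale_def matrix_vector_mult_def sum_2 mat_def algebra_simps)
  finally show ?thesis by (simp add: e_def)
qed

end

theory Submission
  imports Defs
begin

text \<open>
  Write \<open>a = p'(\<rho>) - m\<^sup>2 / \<rho>\<^sup>2\<close>, so that supersonic means \<open>a < 0\<close>. The determinant of the
  spectral matrix is the quadratic
  \<open>\<lambda>\<^sup>2 + (\<mu> \<xi>\<^sup>2 + 2 \<i> \<xi> m / \<rho>) \<lambda> + \<xi>\<^sup>2 (a + k\<^sup>2 \<xi>\<^sup>2 / 2)\<close>.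
  Its constant term is real, and it is negative for small \<open>\<xi> \<noteq> 0\<close>, because the dispersive
  contribution is of higher order than \<open>a\<close>. A real quadratic with negative constant term has
  a positive root. Here only the linear coefficient is complex, and its imaginary part (advection
  with the velocity of the fluid) does not destroy this as long as its real part (viscosity)
  is positive: see \<open>quadratic_root_in_right_half_plane\<close>. Hence every sufficiently long
  wave is amplified (\<open>supersonic_long_wave_unstable\<close>), with no need for an asymptotic expansion
  of the eigenvalues at \<open>\<xi> = 0\<close>.
\<close>

text \<open>
  By the quadratic formula, a root lies in the right half-plane as soon as a square root \<open>w\<close> of the
  discriminant satisfies \<open>Re w > Re c\<close>. With \<open>d = 0\<close> the choice \<open>w = c\<close> gives equality; a negative
  \<open>d\<close> increases \<open>(Re w)\<^sup>2 - (Im w)\<^sup>2\<close> while \<open>Re w * Im w\<close> stays fixed, which forces \<open>\<bar>Re w\<bar>\<close> to grow.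
  The condition \<open>Re c > 0\<close> cannot be relaxed to \<open>Re c \<ge> 0\<close>: the roots of \<open>z\<^sup>2 + 3 \<i> z - 1\<close> are
  purely imaginary.
\<close>

lemma quadratic_root_in_right_half_plane:
  fixes c :: complex and d :: real
  assumes c: "Re c > 0" and d: "d < 0"
  shows "\<exists>z. z\<^sup>2 + c * z + complex_of_real d = 0 \<and> Re z > 0"
proof -
  define w where "w = csqrt (c\<^sup>2 - 4 * complex_of_real d)"
  have w2: "w\<^sup>2 = c\<^sup>2 - 4 * complex_of_real d"
    by (simp add: w_def)
  have diff: "(Re w)\<^sup>2 - (Im w)\<^sup>2 = (Re c)\<^sup>2 - (Im c)\<^sup>2 - 4 * d"
    using arg_cong [OF w2, of Re] by (simp add: power2_eq_square)
  have "Re w * Im w = Re c * Im c"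
    using arg_cong [OF w2, of Im] by (simp add: power2_eq_square mult.commute)
  then have prod: "(Re w)\<^sup>2 * (Im w)\<^sup>2 = (Re c)\<^sup>2 * (Im c)\<^sup>2"
    by (metis power_mult_distrib)
  have "Re w > Re c"
  proof (rule ccontr)
    assume "\<not> Re w > Re c"
    moreover have "Re w \<ge> 0"
      using csqrt_principal [of "c\<^sup>2 - 4 * complex_of_real d"] by (auto simp: w_def)
    ultimately have re: "(Re w)\<^sup>2 \<le> (Re c)\<^sup>2"
      by (intro power_mono) auto
    with diff d have im: "(Im w)\<^sup>2 < (Im c)\<^sup>2"
      by linarith
    have "(Re w)\<^sup>2 * (Im w)\<^sup>2 \<le> (Re c)\<^sup>2 * (Im w)\<^sup>2"
      using re by (intro mult_right_mono) auto
    also have "\<dots> < (Re c)\<^sup>2 * (Im c)\<^sup>2"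
      using im c by (intro mult_strict_left_mono) auto
    finally show False
      using prod by simp
  qed
  moreover have "((w - c) / 2)\<^sup>2 + c * ((w - c) / 2) + complex_of_real d = 0"
  proof -
    have "((w - c) / 2)\<^sup>2 + c * ((w - c) / 2) + complex_of_real d
        = (w\<^sup>2 - c\<^sup>2) / 4 + complex_of_real d"
      by (simp add: power2_eq_square field_simps)
    then show ?thesis
      by (simp add: w2)
  qed
  ultimately show ?thesis
    by (intro exI [of _ "(w - c) / 2"]) auto
qed

text \<open>
  The vector \<open>(\<xi>, \<i> \<lambda>)\<close> is always annihilated by the first row \<open>(\<lambda>, \<i> \<xi>)\<close> of the spectral
  matrix; the second row sends it to \<open>\<i>\<close> times the determinant.
\<close>

lemma spectral_solution_of_determinant_root:
  assumes "\<xi> \<noteq> 0"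
    and root: "lam\<^sup>2 + Complex (\<mu> * \<xi>\<^sup>2) (\<xi> * (2 * m / \<rho>)) * lam
      + complex_of_real (\<xi>\<^sup>2 * (deriv (pressure \<gamma>) \<rho> - m\<^sup>2 / \<rho>\<^sup>2 + k\<^sup>2 / 2 * \<xi>\<^sup>2)) = 0"
  shows "spectral_solution (mat_A \<gamma> \<rho> m) (mat_B \<mu>) (mat_C k) \<xi> lam"
proof -
  define a where "a = deriv (pressure \<gamma>) \<rho> - m\<^sup>2 / \<rho>\<^sup>2"
  define b where "b = 2 * m / \<rho>"
  define \<kappa> where "\<kappa> = k\<^sup>2 / 2"
  define U :: "complex^2" where "U = vector [complex_of_real \<xi>, \<i> * lam]"
  have A: "mat_A \<gamma> \<rho> m = vector [vector [0, 1], vector [a, b]]"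
    and C: "mat_C k = vector [vector [0, 0], vector [\<kappa>, 0]]"
    by (simp_all add: mat_A_def mat_C_def a_def b_def \<kappa>_def)
  have "(spectral_matrix (mat_A \<gamma> \<rho> m) (mat_B \<mu>) (mat_C k) \<xi> lam *v U) $ 2 =
      \<i> * (lam\<^sup>2 + Complex (\<mu> * \<xi>\<^sup>2) (\<xi> * b) * lam + complex_of_real (\<xi>\<^sup>2 * (a + \<kappa> * \<xi>\<^sup>2)))"
    unfolding A C mat_B_def U_def
    by (simp add: spectral_matrix_def cscale_def matrix_vector_mult_def sum_2 mat_def
        complex_eq_iff power2_eq_square power3_eq_cube algebra_simps)
  moreover have "(spectral_matrix (mat_A \<gamma> \<rho> m) (mat_B \<mu>) (mat_C k) \<xi> lam *v U) $ 1 = 0"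
    unfolding A C mat_B_def U_def
    by (simp add: spectral_matrix_def cscale_def matrix_vector_mult_def sum_2 mat_def
        complex_eq_iff)
  ultimately have "spectral_matrix (mat_A \<gamma> \<rho> m) (mat_B \<mu>) (mat_C k) \<xi> lam *v U = 0"
    using root by (simp add: vec_eq_iff forall_2 a_def b_def \<kappa>_def)
  moreover have "U \<noteq> 0"
    using \<open>\<xi> \<noteq> 0\<close> by (simp add: U_def vec_eq_iff forall_2)
  ultimately show ?thesis
    unfolding spectral_solution_def by blast
qed

text \<open>
  The wave numbers of the unstable band are those for which the dispersive term does not outweigh
  the negative entry of the first-order matrix, so that the determinant stays negative at \<open>\<lambda> = 0\<close>.
\<close>

lemma supersonic_long_wave_unstable:
  assumes "\<mu> > 0" and "\<xi> \<noteq> 0"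
    and band: "deriv (pressure \<gamma>) \<rho> - m\<^sup>2 / \<rho>\<^sup>2 + k\<^sup>2 / 2 * \<xi>\<^sup>2 < 0"
  shows "\<exists>lam. spectral_solution (mat_A \<gamma> \<rho> m) (mat_B \<mu>) (mat_C k) \<xi> lam \<and> Re lam > 0"
proof -
  have "Re (Complex (\<mu> * \<xi>\<^sup>2) (\<xi> * (2 * m / \<rho>))) > 0"
    using assms by simp
  moreover have "\<xi>\<^sup>2 * (deriv (pressure \<gamma>) \<rho> - m\<^sup>2 / \<rho>\<^sup>2 + k\<^sup>2 / 2 * \<xi>\<^sup>2) < 0"
    using band \<open>\<xi> \<noteq> 0\<close> by (intro mult_pos_neg) auto
  ultimately show ?thesis
    using quadratic_root_in_right_half_plane spectral_solution_of_determinant_root [OF \<open>\<xi> \<noteq> 0\<close>]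
    by blast
qed

theorem lemma2:
  fixes \<gamma> \<mu> k \<rho> m :: real
  assumes "\<gamma> > 1" and "\<mu> > 0" and "k > 0"
    and "\<rho> > 0"
    and supersonic: "deriv (pressure \<gamma>) \<rho> < m\<^sup>2 / \<rho>\<^sup>2"
  shows "\<not> strictly_dissipative (mat_A \<gamma> \<rho> m) (mat_B \<mu>) (mat_C k) \<and>
    (\<exists>(\<xi>::real) (lam::complex).
       spectral_solution (mat_A \<gamma> \<rho> m) (mat_B \<mu>) (mat_C k) \<xi> lam \<and> Re lam > 0)"
proof -
  define a where "a = deriv (pressure \<gamma>) \<rho> - m\<^sup>2 / \<rho>\<^sup>2"
  have a: "a < 0"
    using supersonic by (simp add: a_def)
  \<comment> \<open>This wave number makes the dispersive term cancel exactly half of \<open>a\<close>.\<close>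
  define \<xi> where "\<xi> = sqrt (- a) / k"
  have "\<xi> \<noteq> 0"
    using a \<open>k > 0\<close> by (simp add: \<xi>_def)
  have "k\<^sup>2 / 2 * \<xi>\<^sup>2 = - a / 2"
    using a \<open>k > 0\<close> by (simp add: \<xi>_def power_divide)
  with a have "deriv (pressure \<gamma>) \<rho> - m\<^sup>2 / \<rho>\<^sup>2 + k\<^sup>2 / 2 * \<xi>\<^sup>2 < 0"
    unfolding a_def [symmetric] by linarith
  from supersonic_long_wave_unstable [OF \<open>\<mu> > 0\<close> \<open>\<xi> \<noteq> 0\<close> this]
  obtain lam where lam: "spectral_solution (mat_A \<gamma> \<rho> m) (mat_B \<mu>) (mat_C k) \<xi> lam" "Re lam > 0"
    by blast
  with \<open>\<xi> \<noteq> 0\<close> have "\<not> strictly_dissipative (mat_A \<gamma> \<rho> m) (mat_B \<mu>) (mat_C k)"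
    unfolding strictly_dissipative_def by (meson less_asym)
  with lam show ?thesis
    by blast
qed

end
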